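(* Let $n\ge1$, let $q\in\mathbb{R}[x_1,\dots,x_n]$ be a quadratic polynomial, and suppose that $S(q)=\{x\in\mathbb{R}^n:q(x)\ge0\}$ is compact and nonempty. Let $E(q)=\{x\in\mathbb{R}^n:q(x)=0\}$ and let $y\in\mathcal{M}_{n,2}$. (a) $y$ has a representing measure supported in $E(q)$ if and only if $M_1(y)\succeq0$ and $L_y(q)=0$. (b) $y$ has a representing measure supported in $S(q)$ if and only if $M_1(y)\succeq0$ and $L_y(q)\ge0$.
   Context: "Quadratic" means of total degree two. $\mathcal{M}_{n,2}$ is the set of all real families $y=(y_\alpha)_{\alpha\in\mathbb{Z}_+^n,|\alpha|\le2}$, where $|\alpha|=\alpha_1+\cdots+\alpha_n$. $M_1(y)$ is the $(n+1)\times(n+1)$ real symmetric matrix with rows and columns indexed by $\alpha,\beta\in\mathbb{Z}_+^n$, $|\alpha|,|\beta|\le1$, and $(\alpha,\beta)$ entry $y_{\alpha+\beta}$; $\succeq0$ means positive semidefinite. The Riesz functional is $L_y\big(\sum_{|\alpha|\le2}p_\alpha x^\alpha\big)=\sum_{|\alpha|\le2}p_\alpha y_\alpha$. A representing measure for $y$ is a positive Borel measure $\mu$ on $\mathbb{R}^n$ with $y_\alpha=\int x^\alpha\,d\mu(x)$ for all $|\alpha|\le2$. *)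

theory Defs
  imports "HOL-Analysis.Analysis" "HOL-Library.Poly_Mapping"
begin

text \<open>Multi-indices over an index type \<open>'n\<close> are finitely supported maps \<open>'n \<Rightarrow>\<^sub>0 nat\<close>, and real
  polynomials in variables indexed by \<open>'n\<close> are \<open>('n \<Rightarrow>\<^sub>0 nat) \<Rightarrow>\<^sub>0 real\<close>, mapping a multi-index to
  its coefficient.\<close>

type_synonym 'n mindex = "'n \<Rightarrow>\<^sub>0 nat"
type_synonym 'n rpoly = "'n mindex \<Rightarrow>\<^sub>0 real"

definition mindex_degree :: "'n::finite mindex \<Rightarrow> nat"
  where "mindex_degree \<alpha> = (\<Sum>i\<in>UNIV. Poly_Mapping.lookup \<alpha> i)"

definition mindices :: "nat \<Rightarrow> 'n::finite mindex set"
  where "mindices d = {\<alpha>. mindex_degree \<alpha> \<le> d}"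

text \<open>The sums over \<open>mindices d\<close> below are genuine finite sums.\<close>

lemma finite_mindices: "finite (mindices d :: 'n::finite mindex set)"
proof (rule finite_imageD)
  have le: "Poly_Mapping.lookup \<alpha> i \<le> d" if "\<alpha> \<in> mindices d" for \<alpha> :: "'n mindex" and i
  proof -
    have "Poly_Mapping.lookup \<alpha> i \<le> (\<Sum>i\<in>UNIV. Poly_Mapping.lookup \<alpha> i)"
      by (rule member_le_sum) auto
    then show ?thesis
      using that by (simp add: mindices_def mindex_degree_def)
  qed
  have "Poly_Mapping.lookup ` (mindices d :: 'n mindex set) \<subseteq> PiE UNIV (\<lambda>_. {..d})"
    using le by (auto simp: PiE_UNIV_domain)
  then show "finite (Poly_Mapping.lookup ` (mindices d :: 'n mindex set))"
    by (rule finite_subset) (auto intro: finite_PiE)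
qed (simp add: inj_on_def)

definition monomial_eval :: "'n::finite mindex \<Rightarrow> real ^ 'n \<Rightarrow> real"
  where "monomial_eval \<alpha> x = (\<Prod>i\<in>UNIV. (x $ i) ^ Poly_Mapping.lookup \<alpha> i)"

definition rpoly_eval :: "'n::finite rpoly \<Rightarrow> real ^ 'n \<Rightarrow> real"
  where "rpoly_eval p x = (\<Sum>\<alpha>\<in>Poly_Mapping.keys p. Poly_Mapping.lookup p \<alpha> * monomial_eval \<alpha> x)"

text \<open>The zero polynomial is given total degree 0.\<close>

definition total_degree :: "'n::finite rpoly \<Rightarrow> nat"
  where "total_degree p = Max (insert 0 (mindex_degree ` Poly_Mapping.keys p))"

definition nonneg_set :: "'n::finite rpoly \<Rightarrow> (real ^ 'n) set"
  where "nonneg_set q = {x. rpoly_eval q x \<ge> 0}"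

definition zero_set :: "'n::finite rpoly \<Rightarrow> (real ^ 'n) set"
  where "zero_set q = {x. rpoly_eval q x = 0}"

text \<open>A truncated moment sequence of degree \<open>d\<close> is a total function \<open>y\<close> on multi-indices of which
  only the values on \<open>mindices d\<close> matter.  The Riesz functional is meant for polynomials of total
  degree at most \<open>d\<close>.\<close>

definition riesz :: "nat \<Rightarrow> ('n::finite mindex \<Rightarrow> real) \<Rightarrow> 'n rpoly \<Rightarrow> real"
  where "riesz d y p = (\<Sum>\<alpha>\<in>mindices d. Poly_Mapping.lookup p \<alpha> * y \<alpha>)"

text \<open>The moment matrix of order \<open>k\<close> is the restriction of \<open>moment_matrix y\<close> to rows and columns in
  \<open>mindices k\<close>; it uses only the values of \<open>y\<close> on \<open>mindices (2 * k)\<close>.\<close>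

definition moment_matrix :: "('n::finite mindex \<Rightarrow> real) \<Rightarrow> 'n mindex \<Rightarrow> 'n mindex \<Rightarrow> real"
  where "moment_matrix y \<alpha> \<beta> = y (\<alpha> + \<beta>)"

definition psd_on :: "'i set \<Rightarrow> ('i \<Rightarrow> 'i \<Rightarrow> real) \<Rightarrow> bool"
  where "psd_on I A \<longleftrightarrow>
    (\<forall>i\<in>I. \<forall>j\<in>I. A i j = A j i) \<and>
    (\<forall>c. 0 \<le> (\<Sum>i\<in>I. \<Sum>j\<in>I. c i * A i j * c j))"

definition measure_support :: "'a::topological_space measure \<Rightarrow> 'a set"
  where "measure_support \<mu> = {x. \<forall>U. open U \<longrightarrow> x \<in> U \<longrightarrow> emeasure \<mu> U > 0}"

text \<open>For a closed set, containing the topological support amounts to carrying all the mass.\<close>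

lemma measure_support_subset_iff:
  fixes \<mu> :: "'a::second_countable_topology measure"
  assumes "sets \<mu> = sets borel" and "closed K"
  shows "measure_support \<mu> \<subseteq> K \<longleftrightarrow> emeasure \<mu> (- K) = 0"
proof
  assume supp: "measure_support \<mu> \<subseteq> K"
  define F where "F = {U. open U \<and> emeasure \<mu> U = 0}"
  have opn: "\<And>U. U \<in> F \<Longrightarrow> open U"
    by (simp add: F_def)
  obtain F' where F': "F' \<subseteq> F" "countable F'" "\<Union>F' = \<Union>F"
    using Lindelof[of F] opn by blast
  have "(\<Union>U\<in>F'. U) \<in> null_sets \<mu>"
    by (rule null_sets_UN') (use F' assms in \<open>auto simp: F_def null_sets_def\<close>)
  moreover have "- K \<subseteq> \<Union>F"
  proof
    fix x assume "x \<in> - K"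
    then have "x \<notin> measure_support \<mu>"
      using supp by blast
    then obtain U where "open U" "x \<in> U" "emeasure \<mu> U = 0"
      by (auto simp: measure_support_def)
    then show "x \<in> \<Union>F"
      by (auto simp: F_def)
  qed
  moreover have "- K \<in> sets \<mu>"
    using assms by auto
  ultimately show "emeasure \<mu> (- K) = 0"
    using F'(3) null_sets_subset[of "\<Union>F" \<mu> "- K"] by auto
next
  assume null: "emeasure \<mu> (- K) = 0"
  show "measure_support \<mu> \<subseteq> K"
  proof
    fix x assume "x \<in> measure_support \<mu>"
    then have "x \<in> - K \<longrightarrow> emeasure \<mu> (- K) > 0"
      using assms(2) by (auto simp: measure_support_def open_Compl)
    with null show "x \<in> K"
      by auto
  qed
qed

text \<open>The Bochner integral of a non-integrable function is 0 by convention, so integrability of the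
  monomials is required explicitly; for the multi-index 0 it says that the measure is finite.\<close>

definition representing_measure ::
    "nat \<Rightarrow> ('n::finite mindex \<Rightarrow> real) \<Rightarrow> (real ^ 'n) measure \<Rightarrow> bool"
  where "representing_measure d y \<mu> \<longleftrightarrow>
    sets \<mu> = sets borel \<and>
    (\<forall>\<alpha>\<in>mindices d. integrable \<mu> (monomial_eval \<alpha>) \<and>
       y \<alpha> = integral\<^sup>L \<mu> (monomial_eval \<alpha>))"

end

theory Submission imports Defs begin

text \<open>
  Write the quadratic polynomial as a quadratic form in the vector of monomials of degree at most
  one: \<open>q(x) = Q((x\<^sup>\<beta>)\<^sub>\<beta>)\<close> with \<open>\<bar>\<beta>\<bar> \<le> 1\<close>.  This \<open>Q\<close> is the homogenisation of \<open>q\<close>, a form on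
  vectors \<open>v = (v\<^sub>\<beta>)\<close> with one more coordinate \<open>v\<^sub>0\<close> than there are variables.  If the moment
  matrix is a sum of rank-one matrices \<open>v\<^sub>k v\<^sub>k\<^sup>T\<close>, then \<open>L\<^sub>y(q) = \<Sum> Q(v\<^sub>k)\<close>.  A vector with
  \<open>v\<^sub>0 \<noteq> 0\<close> is \<open>v\<^sub>0\<close> times the monomial vector of a point \<open>x\<close>, so that \<open>v v\<^sup>T\<close> is the moment
  matrix of the atom of mass \<open>v\<^sub>0\<^sup>2\<close> at \<open>x\<close>, and \<open>Q(v) = v\<^sub>0\<^sup>2 q(x)\<close>.

  Three facts turn this into a proof of sufficiency.  A positive semidefinite matrix is a sum of
  such rank-one matrices (\<open>psd_on_gram\<close>).  If \<open>\<Sum> Q(v\<^sub>k) \<ge> 0\<close>, the vectors can be rotated among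
  each other, which does not change the sum of the \<open>v\<^sub>k v\<^sub>k\<^sup>T\<close>, until every \<open>Q(v\<^sub>k)\<close> is nonnegative
  (\<open>gram_regroup_nonneg\<close>, after Sturm and Zhang).  Finally, as \<open>S(q)\<close> is
  compact, \<open>Q(v) \<ge> 0\<close> and \<open>v\<^sub>0 = 0\<close> leave only \<open>v = 0\<close>: any other such \<open>v\<close> would be the direction
  of a ray inside \<open>S(q)\<close> (\<open>homogenised_at_infinity\<close>).  The result is a finitely atomic measure on \<open>S(q)\<close>;
  if \<open>L\<^sub>y(q) = 0\<close>, the nonnegative numbers \<open>Q(v\<^sub>k)\<close> sum to zero, hence vanish, and the atoms lie
  in \<open>E(q)\<close>.

  Necessity is the usual integration of squares and of \<open>q\<close>.
\<close>

section \<open>Multi-indices\<close>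

lemma mindex_degree_zero [simp]: "mindex_degree 0 = 0"
  by (simp add: mindex_degree_def)

lemma mindex_degree_plus: "mindex_degree (\<alpha> + \<beta>) = mindex_degree \<alpha> + mindex_degree \<beta>"
  by (simp add: mindex_degree_def lookup_add sum.distrib)

lemma mindex_degree_single [simp]: "mindex_degree (Poly_Mapping.single i k) = k"
  by (simp add: mindex_degree_def lookup_single when_def)

lemma mindex_degree_eq_0_iff: "mindex_degree \<alpha> = 0 \<longleftrightarrow> \<alpha> = 0"
  by (auto simp: mindex_degree_def intro!: poly_mapping_eqI)

lemma mindex_cases:
  fixes \<alpha> :: "'n::finite mindex"
  obtains "\<alpha> = 0"
  | i \<beta> where "\<alpha> = Poly_Mapping.single i 1 + \<beta>" "mindex_degree \<alpha> = Suc (mindex_degree \<beta>)"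
proof (cases "\<alpha> = 0")
  case False
  then obtain i where i: "Poly_Mapping.lookup \<alpha> i \<noteq> 0"
    by (metis lookup_zero poly_mapping_eqI)
  have "\<alpha> = Poly_Mapping.single i 1 + (\<alpha> - Poly_Mapping.single i 1)"
    using i by (intro poly_mapping_eqI) (auto simp: lookup_add lookup_minus lookup_single when_def)
  then show ?thesis
    by (metis mindex_degree_plus mindex_degree_single plus_1_eq_Suc that(2))
qed (use that in blast)

lemma mindices_1_cases:
  assumes "\<beta> \<in> mindices 1"
  obtains "\<beta> = 0" | i where "\<beta> = Poly_Mapping.single i 1"
proof (cases \<beta> rule: mindex_cases)
  case (2 i \<gamma>)
  then have "\<gamma> = 0"
    using assms by (simp add: mindices_def mindex_degree_eq_0_iff)
  with 2 that(2) show ?thesis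
    by simp
qed (use that in blast)

lemma zero_in_mindices [simp]: "0 \<in> mindices d"
  by (simp add: mindices_def)

lemma single_in_mindices_1 [simp]: "Poly_Mapping.single i 1 \<in> mindices 1"
  by (simp add: mindices_def)

lemma plus_in_mindices_2: "\<alpha> \<in> mindices 1 \<Longrightarrow> \<beta> \<in> mindices 1 \<Longrightarrow> \<alpha> + \<beta> \<in> mindices 2"
  by (simp add: mindices_def mindex_degree_plus)

lemma mindices_2_split:
  assumes "\<alpha> \<in> mindices 2"
  shows "\<exists>\<beta>\<in>mindices 1. \<exists>\<gamma>\<in>mindices 1. \<alpha> = \<beta> + \<gamma>"
proof (cases \<alpha> rule: mindex_cases)
  case 1
  then show ?thesis
    by (intro bexI[of _ 0]) auto
next
  case (2 i \<beta>)
  then have "\<beta> \<in> mindices 1"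
    using assms by (simp add: mindices_def)
  with 2 show ?thesis
    using single_in_mindices_1 by blast
qed

lemma monomial_eval_zero [simp]: "monomial_eval 0 x = 1"
  by (simp add: monomial_eval_def)

lemma monomial_eval_single [simp]: "monomial_eval (Poly_Mapping.single i (Suc 0)) x = x $ i"
proof -
  have "monomial_eval (Poly_Mapping.single i (Suc 0)) x = (\<Prod>j\<in>UNIV. if j = i then x $ j else 1)"
    unfolding monomial_eval_def by (rule prod.cong) (auto simp: lookup_single when_def)
  then show ?thesis
    by simp
qed

lemma monomial_eval_plus: "monomial_eval (\<alpha> + \<beta>) x = monomial_eval \<alpha> x * monomial_eval \<beta> x"
  by (simp add: monomial_eval_def lookup_add power_add prod.distrib)

lemma continuous_monomial_eval [continuous_intros]: "continuous_on A (monomial_eval \<alpha>)"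
  unfolding monomial_eval_def by (intro continuous_intros)

lemma continuous_rpoly_eval: "continuous_on A (rpoly_eval q)"
  unfolding rpoly_eval_def by (intro continuous_intros)

lemma closed_zero_set: "closed (zero_set q)"
  unfolding zero_set_def
  by (intro closed_Collect_eq continuous_rpoly_eval continuous_on_const)

lemma closed_nonneg_set: "closed (nonneg_set q)"
  unfolding nonneg_set_def
  by (intro closed_Collect_le continuous_rpoly_eval continuous_on_const)

lemma rpoly_eval_eq_sum_mindices:
  assumes "total_degree q \<le> d"
  shows "rpoly_eval q x = (\<Sum>\<alpha>\<in>mindices d. Poly_Mapping.lookup q \<alpha> * monomial_eval \<alpha> x)"
proof -
  have "Poly_Mapping.keys q \<subseteq> mindices d"
    using assms by (auto simp: total_degree_def mindices_def)
  then show ?thesis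
    unfolding rpoly_eval_def
    by (intro sum.mono_neutral_left finite_mindices) (auto simp: in_keys_iff)
qed

section \<open>Moments of a measure\<close>

lemma riesz_eq_integral:
  assumes "representing_measure d y \<mu>" and "total_degree q \<le> d"
  shows "riesz d y q = integral\<^sup>L \<mu> (rpoly_eval q)"
proof -
  have "rpoly_eval q = (\<lambda>x. \<Sum>\<alpha>\<in>mindices d. Poly_Mapping.lookup q \<alpha> * monomial_eval \<alpha> x)"
    by (rule ext) (rule rpoly_eval_eq_sum_mindices[OF assms(2)])
  then show ?thesis
    using assms(1)
    by (simp add: representing_measure_def riesz_def Bochner_Integration.integral_sum)
qed

lemma psd_on_moment_matrix:
  fixes \<mu> :: "(real ^ 'n::finite) measure"
  assumes "representing_measure 2 y \<mu>"
  shows "psd_on (mindices 1) (moment_matrix y)"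
  unfolding psd_on_def
proof (intro conjI ballI allI)
  fix c :: "'n mindex \<Rightarrow> real"
  let ?I = "mindices 1 :: 'n mindex set"
  have int: "integrable \<mu> (monomial_eval (i + j))" 
    and y: "y (i + j) = integral\<^sup>L \<mu> (monomial_eval (i + j))" if "i \<in> ?I" "j \<in> ?I" for i j
    using assms plus_in_mindices_2[OF that] by (auto simp: representing_measure_def)
  have "(\<Sum>i\<in>?I. \<Sum>j\<in>?I. c i * moment_matrix y i j * c j) =
      (\<integral>x. (\<Sum>i\<in>?I. \<Sum>j\<in>?I. c i * monomial_eval (i + j) x * c j) \<partial>\<mu>)"
    using int y by (simp add: moment_matrix_def Bochner_Integration.integral_sum)
  also have "\<dots> = (\<integral>x. (\<Sum>i\<in>?I. c i * monomial_eval i x)\<^sup>2 \<partial>\<mu>)"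
    by (simp add: power2_eq_square sum_product monomial_eval_plus ac_simps)
  finally show "0 \<le> (\<Sum>i\<in>?I. \<Sum>j\<in>?I. c i * moment_matrix y i j * c j)"
    by simp
qed (simp add: moment_matrix_def add.commute)

lemma AE_in_measure_support:
  fixes \<mu> :: "'a::second_countable_topology measure"
  assumes "sets \<mu> = sets borel" and "closed K" and "measure_support \<mu> \<subseteq> K"
  shows "AE x in \<mu>. x \<in> K"
proof (rule AE_I')
  show "- K \<in> null_sets \<mu>"
    using assms measure_support_subset_iff[of \<mu> K] by (auto simp: null_sets_def)
qed auto

section \<open>Gram vectors\<close>

lemma psd_on_sym: "psd_on I A \<Longrightarrow> i \<in> I \<Longrightarrow> j \<in> I \<Longrightarrow> A i j = A j i"
  unfolding psd_on_def by blast

lemma psd_on_nonneg: "psd_on I A \<Longrightarrow> 0 \<le> (\<Sum>i\<in>I. \<Sum>j\<in>I. c i * A i j * c j)"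
  by (auto simp: psd_on_def)

text \<open>The form at \<open>t e\<^sub>p + e\<^sub>j\<close> is affine in \<open>t\<close> when the diagonal entry vanishes, and an affine
  function bounded below has slope zero.\<close>

lemma psd_on_zero_diagonal:
  assumes "psd_on I A" and "finite I" and "p \<in> I" "j \<in> I" and "A p p = 0"
  shows "A p j = 0"
proof (cases "j = p")
  case False
  have sym: "A j p = A p j"
    using psd_on_sym[OF assms(1)] assms(3,4) by blast
  have "0 \<le> 2 * t * A p j + A j j" for t
  proof -
    let ?c = "\<lambda>i. if i = p then t else if i = j then 1 else 0 :: real"
    have "(\<Sum>k\<in>I. ?c i * A i k * ?c k) = ?c i * A i p * t + ?c i * A i j" for i
    proof -
      have "(\<Sum>k\<in>I. ?c i * A i k * ?c k) =
          (\<Sum>k\<in>I. (if k = p then ?c i * A i p * t else 0) + (if k = j then ?c i * A i j else 0))"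
        using False by (intro sum.cong) auto
      then show ?thesis
        using assms by (simp add: sum.distrib)
    qed
    moreover have "(\<Sum>i\<in>I. ?c i * A i p * t + ?c i * A i j) =
        (\<Sum>i\<in>I. (if i = p then t * A p p * t + t * A p j else 0) +
                (if i = j then A j p * t + A j j else 0))"
      using False by (intro sum.cong) auto
    ultimately have "(\<Sum>i\<in>I. \<Sum>k\<in>I. ?c i * A i k * ?c k) = 2 * t * A p j + A j j"
      using assms sym by (simp add: sum.distrib)
    then show ?thesis
      using psd_on_nonneg[OF assms(1), of ?c] by simp
  qed
  \<comment> \<open>this \<open>t\<close> makes the affine function equal to \<open>-1\<close>\<close>
  from this[of "- (A j j + 1) / (2 * A p j)"] show ?thesis
    by (cases "A p j = 0") (simp_all add: field_simps)
qed (use assms in simp)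

text \<open>For given coefficients on \<open>I\<close>, minimising the form over the coefficient at \<open>p\<close> leaves the
  form of the Schur complement; the minimiser is the value \<open>d p\<close> below.\<close>

lemma psd_on_schur_complement:
  assumes "psd_on (insert p I) A" and "finite I" and "p \<notin> I" and "A p p > 0"
  shows "psd_on I (\<lambda>i j. A i j - A p i * A p j / A p p)"
  unfolding psd_on_def
proof (intro conjI ballI allI)
  fix c :: "'a \<Rightarrow> real"
  define s where "s = (\<Sum>i\<in>I. c i * A p i)"
  define d where "d = c(p := - s / A p p)"
  have sym: "A i p = A p i" if "i \<in> I" for i
    using psd_on_sym[OF assms(1)] that by blast
  have d: "d p = - s / A p p" "\<And>i. i \<in> I \<Longrightarrow> d i = c i"
    using assms by (auto simp: d_def)
  have s': "(\<Sum>j\<in>I. d p * A p j * d j) = d p * s"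
    unfolding s_def sum_distrib_left by (intro sum.cong) (auto simp: d(2))
  have s'': "(\<Sum>i\<in>I. d i * A i p * d p) = d p * s"
    unfolding s_def sum_distrib_left by (intro sum.cong) (auto simp: d(2) sym)
  have "0 \<le> (\<Sum>i\<in>insert p I. \<Sum>j\<in>insert p I. d i * A i j * d j)"
    by (rule psd_on_nonneg[OF assms(1)])
  also have "\<dots> = d p * A p p * d p + 2 * (d p * s) + (\<Sum>i\<in>I. \<Sum>j\<in>I. d i * A i j * d j)"
    using assms s' s'' by (simp add: sum.distrib)
  also have "(\<Sum>i\<in>I. \<Sum>j\<in>I. d i * A i j * d j) = (\<Sum>i\<in>I. \<Sum>j\<in>I. c i * A i j * c j)"
    by (simp add: d(2))
  also have "d p * A p p * d p + 2 * (d p * s) = - (s * s / A p p)"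
    using assms by (simp add: d(1) field_simps)
  also have "s * s / A p p = (\<Sum>i\<in>I. \<Sum>j\<in>I. c i * (A p i * A p j / A p p) * c j)"
    unfolding s_def sum_product sum_divide_distrib by (intro sum.cong refl) simp
  finally show "0 \<le> (\<Sum>i\<in>I. \<Sum>j\<in>I. c i * (A i j - A p i * A p j / A p p) * c j)"
    by (simp add: right_diff_distrib left_diff_distrib sum_subtractf)
next
  fix i j assume "i \<in> I" "j \<in> I"
  then have "A i j = A j i"
    using psd_on_sym[OF assms(1)] by blast
  then show "A i j - A p i * A p j / A p p = A j i - A p j * A p i / A p p"
    by simp
qed

lemma psd_on_remove:
  assumes "psd_on (insert p I) A" and "finite I" and "p \<notin> I"
  shows "psd_on I A"
  unfolding psd_on_def
proof (intro conjI ballI allI)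
  fix c :: "'a \<Rightarrow> real"
  have "0 \<le> (\<Sum>i\<in>insert p I. \<Sum>j\<in>insert p I. (c(p := 0)) i * A i j * (c(p := 0)) j)"
    by (rule psd_on_nonneg[OF assms(1)])
  also have "\<dots> = (\<Sum>i\<in>I. \<Sum>j\<in>I. (c(p := 0)) i * A i j * (c(p := 0)) j)"
    using assms by simp
  also have "\<dots> = (\<Sum>i\<in>I. \<Sum>j\<in>I. c i * A i j * c j)"
    using assms(3) by (intro sum.cong) auto
  finally show "0 \<le> (\<Sum>i\<in>I. \<Sum>j\<in>I. c i * A i j * c j)" .
qed (use psd_on_sym[OF assms(1)] in blast)

text \<open>One step of Cholesky elimination per index: subtracting \<open>b b\<^sup>T\<close> with \<open>b\<close> the scaled row of
  the pivot \<open>p\<close> clears that row and leaves a positive semidefinite matrix on the other indices.  The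
  Gram vectors are indexed by \<open>I\<close> itself, one for each pivot.\<close>

lemma psd_on_gram:
  assumes "finite I" and "psd_on I A"
  shows "\<exists>v. \<forall>i\<in>I. \<forall>j\<in>I. A i j = (\<Sum>k\<in>I. v k i * v k j)"
  using assms
proof (induction I arbitrary: A rule: finite_induct)
  case (insert p I)
  have sym: "A i p = A p i" if "i \<in> I" for i
    using psd_on_sym[OF insert.prems] that by blast
  \<comment> \<open>for a zero pivot this is the zero vector, as division by zero yields zero\<close>
  define b where "b = (\<lambda>i. A p i / sqrt (A p p))"
  have nonneg: "A p p \<ge> 0"
  proof -
    let ?c = "\<lambda>i. if i = p then 1 else 0 :: real"
    have "0 \<le> (\<Sum>i\<in>insert p I. \<Sum>j\<in>insert p I. ?c i * A i j * ?c j)"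
      by (rule psd_on_nonneg[OF insert.prems])
    also have "\<dots> = (\<Sum>i\<in>insert p I. if i = p then A p p else 0)"
      using insert.hyps by (intro sum.cong) (auto simp: if_distrib cong: if_cong)
    finally show ?thesis
      using insert.hyps by simp
  qed
  have row: "b p * b j = A p j" if "j \<in> insert p I" for j
  proof (cases "A p p = 0")
    case True
    then show ?thesis
      using psd_on_zero_diagonal[OF insert.prems _ _ that] insert.hyps by (simp add: b_def)
  next
    case False
    then show ?thesis
      using nonneg by (simp add: b_def)
  qed
  have "psd_on I (\<lambda>i j. A i j - b i * b j)"
  proof (cases "A p p = 0")
    case True
    then show ?thesis
      using psd_on_remove[OF insert.prems] insert.hyps by (simp add: b_def)
  next
    case False
    with nonneg have "b i * b j = A p i * A p j / A p p" for i j
      by (simp add: b_def)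
    then show ?thesis
      using psd_on_schur_complement[OF insert.prems] insert.hyps nonneg False by simp
  qed
  then obtain v where v: "\<forall>i\<in>I. \<forall>j\<in>I. A i j - b i * b j = (\<Sum>k\<in>I. v k i * v k j)"
    using insert.IH by blast
  define w where "w = (\<lambda>k. if k = p then b else (v k)(p := 0))"
  have w: "(\<Sum>k\<in>insert p I. w k i * w k j) =
      b i * b j + (\<Sum>k\<in>I. ((v k)(p := 0)) i * ((v k)(p := 0)) j)" for i j
  proof -
    have "(\<Sum>k\<in>I. w k i * w k j) = (\<Sum>k\<in>I. ((v k)(p := 0)) i * ((v k)(p := 0)) j)"
      using insert.hyps by (intro sum.cong) (auto simp: w_def)
    then show ?thesis
      using insert.hyps by (simp add: w_def)
  qed
  have "A i j = (\<Sum>k\<in>insert p I. w k i * w k j)" if ij: "i \<in> insert p I" "j \<in> insert p I" for i j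
  proof -
    consider "i = p" | "i \<in> I" "j = p" | "i \<in> I" "j \<in> I" "i \<noteq> p" "j \<noteq> p"
      using \<open>p \<notin> I\<close> ij by blast
    then show ?thesis
    proof cases
      case 1
      then show ?thesis
        using row[OF ij(2)] by (simp add: w)
    next
      case 2
      then show ?thesis
        using row[OF ij(1)] by (simp add: w sym mult.commute)
    next
      case 3
      then show ?thesis
        using bspec[OF bspec[OF v 3(1)] 3(2)] by (simp add: w)
    qed
  qed
  then show ?case
    by blast
qed auto

section \<open>Rotating Gram vectors\<close>

text \<open>A quadratic form is given by its monomials \<open>v\<^bsub>l a\<^esub> v\<^bsub>r a\<^esub>\<close> with coefficients \<open>c a\<close>
  rather than by a symmetric matrix, because the coefficients of a polynomial are indexed by its
  monomials and each occurs once.\<close>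

definition quad_form ::
    "'a set \<Rightarrow> ('a \<Rightarrow> real) \<Rightarrow> ('a \<Rightarrow> 'i) \<Rightarrow> ('a \<Rightarrow> 'i) \<Rightarrow> ('i \<Rightarrow> real) \<Rightarrow> real"
  where "quad_form J c l r v = (\<Sum>a\<in>J. c a * (v (l a) * v (r a)))"

text \<open>The sum of a quadratic form over a family depends only on the Gram sums of the family, here
  written on the right.\<close>

lemma sum_quad_form:
  "(\<Sum>k\<in>K. quad_form J c l r (v k)) = (\<Sum>a\<in>J. c a * (\<Sum>k\<in>K. v k (l a) * v k (r a)))"
  unfolding quad_form_def by (subst sum.swap) (simp add: sum_distrib_left)

lemma quad_form_line:
  "\<exists>b. \<forall>t. quad_form J c l r (\<lambda>i. u i + t * v i) =
    quad_form J c l r u + t * b + t\<^sup>2 * quad_form J c l r v"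
proof (intro exI allI)
  fix t :: real
  show "quad_form J c l r (\<lambda>i. u i + t * v i) =
    quad_form J c l r u + t * (\<Sum>a\<in>J. c a * (u (l a) * v (r a) + v (l a) * u (r a))) +
    t\<^sup>2 * quad_form J c l r v"
    unfolding quad_form_def sum_distrib_left sum.distrib[symmetric]
    by (rule sum.cong) (auto simp: algebra_simps power2_eq_square)
qed

text \<open>If the form is negative at \<open>v\<^sub>q\<close>, it is positive at some \<open>v\<^sub>p\<close>, since the sum is nonnegative.
  A rotation in the plane of the two takes \<open>v\<^sub>p\<close> continuously to \<open>v\<^sub>q\<close>, so for some angle the form
  vanishes at the rotated \<open>v\<^sub>p\<close>.  As a rotation preserves the Gram sums, it preserves the sum of the
  form, and the number of vectors at which the form is nonzero has gone down.\<close>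

lemma gram_regroup_nonneg:
  fixes v :: "'k \<Rightarrow> 'i \<Rightarrow> real"
  assumes "finite K" and "0 \<le> (\<Sum>k\<in>K. quad_form J c l r (v k))"
  shows "\<exists>w. (\<forall>i j. (\<Sum>k\<in>K. w k i * w k j) = (\<Sum>k\<in>K. v k i * v k j)) \<and>
             (\<forall>k\<in>K. 0 \<le> quad_form J c l r (w k))"
  using assms(2)
proof (induction "card {k\<in>K. quad_form J c l r (v k) \<noteq> 0}" arbitrary: v rule: less_induct)
  case less
  let ?f = "quad_form J c l r"
  show ?case
  proof (cases "\<forall>k\<in>K. 0 \<le> ?f (v k)")
    case False
    then obtain q where q: "q \<in> K" "?f (v q) < 0"
      by (auto simp: not_le)
    obtain p where p: "p \<in> K" "?f (v p) > 0"
    proof (rule ccontr)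
      assume "\<not> thesis"
      then have "\<forall>k\<in>K. ?f (v k) \<le> 0"
        using that by (meson not_le)
      then have "(\<Sum>k\<in>K. ?f (v k)) < (\<Sum>k\<in>K. 0)"
        using q \<open>finite K\<close> by (intro sum_strict_mono_ex1) auto
      with less.prems show False
        by simp
    qed
    have "p \<noteq> q"
      using p q by auto
    have "\<exists>\<theta>\<ge>0. \<theta> \<le> pi / 2 \<and> ?f (\<lambda>i. cos \<theta> * v p i + sin \<theta> * v q i) = 0"
    proof (rule IVT2')
      show "continuous_on {0..pi / 2} (\<lambda>\<theta>. ?f (\<lambda>i. cos \<theta> * v p i + sin \<theta> * v q i))"
        unfolding quad_form_def by (intro continuous_intros)
    qed (use p q in auto)
    then obtain \<theta> where \<theta>: "?f (\<lambda>i. cos \<theta> * v p i + sin \<theta> * v q i) = 0"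
      by blast
    define w where "w = v(p := (\<lambda>i. cos \<theta> * v p i + sin \<theta> * v q i),
                          q := (\<lambda>i. cos \<theta> * v q i - sin \<theta> * v p i))"
    have wp: "w p = (\<lambda>i. cos \<theta> * v p i + sin \<theta> * v q i)"
      and wq: "w q = (\<lambda>i. cos \<theta> * v q i - sin \<theta> * v p i)"
      and w: "\<And>k. k \<noteq> p \<Longrightarrow> k \<noteq> q \<Longrightarrow> w k = v k"
      using \<open>p \<noteq> q\<close> by (auto simp: w_def)
    have gram: "(\<Sum>k\<in>K. w k i * w k j) = (\<Sum>k\<in>K. v k i * v k j)" for i j
    proof -
      have split: "(\<Sum>k\<in>K. g k) = g p + g q + (\<Sum>k\<in>K - {p} - {q}. g k)" for g :: "'k \<Rightarrow> real"
        using \<open>finite K\<close> p q \<open>p \<noteq> q\<close>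
        by (simp add: sum.remove[of K p] sum.remove[of "K - {p}" q])
      have "w p i * w p j + w q i * w q j =
          ((cos \<theta>)\<^sup>2 + (sin \<theta>)\<^sup>2) * (v p i * v p j + v q i * v q j)"
        unfolding wp wq by algebra
      moreover have "(\<Sum>k\<in>K - {p} - {q}. w k i * w k j) = (\<Sum>k\<in>K - {p} - {q}. v k i * v k j)"
        by (intro sum.cong) (auto simp: w)
      ultimately show ?thesis
        unfolding split by simp
    qed
    have "{k\<in>K. ?f (w k) \<noteq> 0} \<subset> {k\<in>K. ?f (v k) \<noteq> 0}"
    proof
      have "?f (v k) \<noteq> 0" if "?f (w k) \<noteq> 0" for k
        using that p(2) q(2) w[of k] by (cases "k = p \<or> k = q") auto
      then show "{k\<in>K. ?f (w k) \<noteq> 0} \<subseteq> {k\<in>K. ?f (v k) \<noteq> 0}"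
        by blast
      have "?f (w p) = 0" and "?f (v p) \<noteq> 0"
        using p(2) \<theta> by (simp_all add: wp)
      then show "{k\<in>K. ?f (w k) \<noteq> 0} \<noteq> {k\<in>K. ?f (v k) \<noteq> 0}"
        using p(1) by blast
    qed
    then have "card {k\<in>K. ?f (w k) \<noteq> 0} < card {k\<in>K. ?f (v k) \<noteq> 0}"
      using \<open>finite K\<close> by (intro psubset_card_mono) auto
    moreover have "0 \<le> (\<Sum>k\<in>K. ?f (w k))"
      using less.prems by (simp add: sum_quad_form gram)
    ultimately show ?thesis
      using less.hyps[of w] by (simp add: gram)
  qed blast
qed

section \<open>Homogenisation\<close>

text \<open>A multi-index of degree at most two can be a sum of two of degree at most one in several
  ways, for instance in either order; any fixed choice serves to write a monomial of
  \<open>q\<close> as a product of two coordinates.\<close>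

definition mindex_split :: "'n::finite mindex \<Rightarrow> 'n mindex \<times> 'n mindex"
  where "mindex_split \<alpha> =
    (SOME p. fst p \<in> mindices 1 \<and> snd p \<in> mindices 1 \<and> \<alpha> = fst p + snd p)"

lemma mindex_split:
  assumes "\<alpha> \<in> mindices 2"
  shows "fst (mindex_split \<alpha>) \<in> mindices 1" "snd (mindex_split \<alpha>) \<in> mindices 1"
    "fst (mindex_split \<alpha>) + snd (mindex_split \<alpha>) = \<alpha>"
proof -
  have "\<exists>p. fst p \<in> mindices 1 \<and> snd p \<in> mindices 1 \<and> \<alpha> = fst p + snd p"
    using mindices_2_split[OF assms] by fastforce
  from someI_ex[OF this, folded mindex_split_def]
  show "fst (mindex_split \<alpha>) \<in> mindices 1" "snd (mindex_split \<alpha>) \<in> mindices 1"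
    "fst (mindex_split \<alpha>) + snd (mindex_split \<alpha>) = \<alpha>"
    by simp_all
qed

definition homogenised :: "'n::finite rpoly \<Rightarrow> ('n mindex \<Rightarrow> real) \<Rightarrow> real"
  where "homogenised q = quad_form (mindices 2) (Poly_Mapping.lookup q)
    (\<lambda>\<alpha>. fst (mindex_split \<alpha>)) (\<lambda>\<alpha>. snd (mindex_split \<alpha>))"

lemma homogenised_cong:
  assumes "\<And>\<beta>. \<beta> \<in> mindices 1 \<Longrightarrow> u \<beta> = v \<beta>"
  shows "homogenised q u = homogenised q v"
  unfolding homogenised_def quad_form_def
  by (intro sum.cong refl arg_cong2[where f = "(*)"] assms mindex_split)

lemma homogenised_monomials:
  assumes "total_degree q \<le> 2"
  shows "homogenised q (\<lambda>\<beta>. s * monomial_eval \<beta> x) = s\<^sup>2 * rpoly_eval q x"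
  unfolding homogenised_def quad_form_def rpoly_eval_eq_sum_mindices[OF assms] sum_distrib_left
  by (intro sum.cong)
     (auto simp: mindex_split power2_eq_square simp flip: monomial_eval_plus)

lemma sum_homogenised_eq_riesz:
  assumes "\<And>\<beta> \<gamma>. \<beta> \<in> mindices 1 \<Longrightarrow> \<gamma> \<in> mindices 1 \<Longrightarrow> y (\<beta> + \<gamma>) = (\<Sum>k\<in>K. v k \<beta> * v k \<gamma>)"
  shows "(\<Sum>k\<in>K. homogenised q (v k)) = riesz 2 y q"
  unfolding homogenised_def sum_quad_form riesz_def
  by (intro sum.cong refl arg_cong2[where f = "(*)"])
     (metis assms mindex_split)

text \<open>The vector \<open>v\<close> is a direction \<open>u\<close>, as its coordinate at \<open>0\<close> vanishes, and on the line
  \<open>x + t u\<close> the polynomial is \<open>q(x) + t b + t\<^sup>2 Q(v)\<close>.  If \<open>q(x)\<close> and \<open>Q(v)\<close> are nonnegative, so is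
  this on the half-line where \<open>t b \<ge> 0\<close>.  A bounded \<open>S(q)\<close> contains no ray, so \<open>u = 0\<close>.\<close>

lemma homogenised_at_infinity:
  fixes q :: "'n::finite rpoly"
  assumes deg: "total_degree q \<le> 2" and "bounded (nonneg_set q)" and "nonneg_set q \<noteq> {}"
    and "v 0 = 0" and "0 \<le> homogenised q v" and "\<beta> \<in> mindices 1"
  shows "v \<beta> = 0"
proof -
  obtain x where x: "0 \<le> rpoly_eval q x"
    using assms by (auto simp: nonneg_set_def)
  define u :: "real ^ 'n" where "u = (\<chi> i. v (Poly_Mapping.single i 1))"
  obtain b where b: "\<And>t. homogenised q (\<lambda>\<beta>. monomial_eval \<beta> x + t * v \<beta>) =
      homogenised q (\<lambda>\<beta>. monomial_eval \<beta> x) + t * b + t\<^sup>2 * homogenised q v"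
    using quad_form_line[of "mindices 2" "Poly_Mapping.lookup q" "\<lambda>\<alpha>. fst (mindex_split \<alpha>)"
        "\<lambda>\<alpha>. snd (mindex_split \<alpha>)" "\<lambda>\<beta>. monomial_eval \<beta> x" v]
    unfolding homogenised_def by blast
  have eval: "rpoly_eval q (x + t *\<^sub>R u) = rpoly_eval q x + t * b + t\<^sup>2 * homogenised q v" for t
  proof -
    have "homogenised q (\<lambda>\<beta>. monomial_eval \<beta> (x + t *\<^sub>R u)) =
        homogenised q (\<lambda>\<beta>. monomial_eval \<beta> x + t * v \<beta>)"
    proof (rule homogenised_cong)
      fix \<beta> :: "'n mindex" assume "\<beta> \<in> mindices 1"
      then show "monomial_eval \<beta> (x + t *\<^sub>R u) = monomial_eval \<beta> x + t * v \<beta>"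
        using \<open>v 0 = 0\<close> by (cases rule: mindices_1_cases) (auto simp: u_def)
    qed
    then show ?thesis
      using b[of t] homogenised_monomials[OF deg, of 1] by simp
  qed
  define \<sigma> where "\<sigma> = (if 0 \<le> b then 1 else - 1 :: real)"
  have ray: "x + (\<sigma> * t) *\<^sub>R u \<in> nonneg_set q" if "0 \<le> t" for t
    using x assms that by (auto simp: nonneg_set_def eval \<sigma>_def mult_nonneg_nonpos)
  obtain B where B: "\<And>z. z \<in> nonneg_set q \<Longrightarrow> norm z \<le> B"
    using \<open>bounded (nonneg_set q)\<close> by (auto simp: bounded_iff)
  have "u = 0"
  proof (rule ccontr)
    assume "u \<noteq> 0"
    \<comment> \<open>far enough along the ray that \<open>norm x\<close> cannot bring the point back within \<open>B\<close>\<close>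
    define t where "t = (B + norm x + 1) / norm u"
    have "0 \<le> B"
      using B[OF ray[of 0]] norm_ge_zero order_trans by blast
    then have "0 \<le> t"
      by (simp add: t_def)
    then have "norm ((\<sigma> * t) *\<^sub>R u) = B + norm x + 1"
      using \<open>u \<noteq> 0\<close> \<open>0 \<le> B\<close> by (simp add: t_def \<sigma>_def abs_mult)
    moreover have "norm ((\<sigma> * t) *\<^sub>R u) \<le> norm (x + (\<sigma> * t) *\<^sub>R u) + norm x"
      using norm_triangle_ineq4[of "x + (\<sigma> * t) *\<^sub>R u" x] by simp
    ultimately show False
      using B[OF ray[OF \<open>0 \<le> t\<close>]] by linarith
  qed
  then have "v (Poly_Mapping.single i 1) = 0" for i
    by (simp add: u_def vec_eq_iff)
  then show ?thesis
    using \<open>v 0 = 0\<close> mindices_1_cases[OF \<open>\<beta> \<in> mindices 1\<close>] by metis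
qed

section \<open>Atomic measures\<close>

lemma atomic_representing_measure:
  fixes x :: "'k \<Rightarrow> real ^ 'n::finite"
  assumes "finite K" and "\<And>k. k \<in> K \<Longrightarrow> 0 \<le> w k"
    and y: "\<And>\<alpha>. \<alpha> \<in> mindices d \<Longrightarrow> y \<alpha> = (\<Sum>k\<in>K. w k * monomial_eval \<alpha> (x k))"
    and "closed S" and "\<And>k. k \<in> K \<Longrightarrow> x k \<in> S"
  shows "\<exists>\<mu>. representing_measure d y \<mu> \<and> measure_support \<mu> \<subseteq> S"
proof -
  define M where "M = point_measure K (\<lambda>k. ennreal (w k))"
  define \<mu> where "\<mu> = distr M borel x"
  have x: "x \<in> measurable M borel"
    by (simp add: M_def measurable_point_measure_eq1)
  have mono: "monomial_eval \<alpha> \<in> borel_measurable borel" for \<alpha> :: "'n mindex"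
    by (intro borel_measurable_continuous_onI continuous_monomial_eval)
  have "representing_measure d y \<mu>"
    unfolding representing_measure_def
  proof (intro conjI ballI)
    fix \<alpha> :: "'n mindex" assume "\<alpha> \<in> mindices d"
    show "integrable \<mu> (monomial_eval \<alpha>)"
      unfolding \<mu>_def integrable_distr_eq[OF x mono] unfolding M_def
      using assms by (intro integrable_point_measure_finite) auto
    show "y \<alpha> = integral\<^sup>L \<mu> (monomial_eval \<alpha>)"
      unfolding \<mu>_def integral_distr[OF x mono] y[OF \<open>\<alpha> \<in> mindices d\<close>] unfolding M_def
      using assms by (simp add: lebesgue_integral_point_measure_finite)
  qed (simp add: \<mu>_def)
  moreover have "measure_support \<mu> \<subseteq> S"
  proof -
    have "x -` (- S) \<inter> space M = {}"
      using assms by (auto simp: M_def space_point_measure)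
    then have "emeasure \<mu> (- S) = 0"
      using \<open>closed S\<close> x by (simp add: \<mu>_def emeasure_distr)
    then show ?thesis
      using measure_support_subset_iff[of \<mu> S] \<open>closed S\<close> by (simp add: \<mu>_def)
  qed
  ultimately show ?thesis
    by blast
qed

text \<open>The atoms are the points with homogeneous coordinates \<open>u\<^sub>k\<close>.  A vector without a point, one
  whose coordinate at \<open>0\<close> vanishes, is zero and contributes nothing to the moments.  The
  value of the Riesz functional at \<open>q\<close> is part of the conclusion because it forces the atoms onto the zero set when it vanishes.\<close>

lemma psd_moment_atoms:
  fixes q :: "'n::finite rpoly" and y :: "'n mindex \<Rightarrow> real"
  assumes deg: "total_degree q \<le> 2" and "bounded (nonneg_set q)" and "nonneg_set q \<noteq> {}"
    and "psd_on (mindices 1) (moment_matrix y)" and "0 \<le> riesz 2 y q"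
  shows "\<exists>(K :: 'n mindex set) w x. finite K \<and> (\<forall>k\<in>K. 0 < w k) \<and>
    (\<forall>k\<in>K. 0 \<le> rpoly_eval q (x k)) \<and>
    (\<forall>\<alpha>\<in>mindices 2. y \<alpha> = (\<Sum>k\<in>K. w k * monomial_eval \<alpha> (x k))) \<and>
    riesz 2 y q = (\<Sum>k\<in>K. w k * rpoly_eval q (x k))"
proof -
  let ?I = "mindices 1 :: 'n mindex set"
  obtain v where v: "\<forall>\<beta>\<in>?I. \<forall>\<gamma>\<in>?I. y (\<beta> + \<gamma>) = (\<Sum>k\<in>?I. v k \<beta> * v k \<gamma>)"
    using psd_on_gram[OF finite_mindices assms(4)] by (auto simp: moment_matrix_def)
  then have "0 \<le> (\<Sum>k\<in>?I. homogenised q (v k))"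
    using assms(5) sum_homogenised_eq_riesz[of y v ?I q] by simp
  then have "\<exists>u. (\<forall>\<beta> \<gamma>. (\<Sum>k\<in>?I. u k \<beta> * u k \<gamma>) = (\<Sum>k\<in>?I. v k \<beta> * v k \<gamma>)) \<and>
      (\<forall>k\<in>?I. 0 \<le> homogenised q (u k))"
    unfolding homogenised_def by (rule gram_regroup_nonneg[OF finite_mindices])
  then obtain u where gram: "\<And>\<beta> \<gamma>. (\<Sum>k\<in>?I. u k \<beta> * u k \<gamma>) = (\<Sum>k\<in>?I. v k \<beta> * v k \<gamma>)"
    and nonneg: "\<And>k. k \<in> ?I \<Longrightarrow> 0 \<le> homogenised q (u k)"
    by blast
  define K where "K = {k\<in>?I. u k 0 \<noteq> 0}"
  define x :: "'n mindex \<Rightarrow> real ^ 'n" where "x = (\<lambda>k. \<chi> i. u k (Poly_Mapping.single i 1) / u k 0)"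
  have finite: "finite K"
    unfolding K_def by (rule finite_subset[OF _ finite_mindices[of 1]]) blast
  have at_infinity: "u k \<beta> = 0" if "k \<in> ?I - K" "\<beta> \<in> ?I" for k \<beta>
    using homogenised_at_infinity[OF deg assms(2,3) _ nonneg that(2)] that(1) by (auto simp: K_def)
  have u: "u k \<beta> = u k 0 * monomial_eval \<beta> (x k)" if "k \<in> K" "\<beta> \<in> ?I" for k \<beta>
    using that(2,1)
    by (cases rule: mindices_1_cases) (auto simp: x_def K_def)
  have hom: "homogenised q (u k) = (u k 0)\<^sup>2 * rpoly_eval q (x k)" if "k \<in> K" for k
    using homogenised_cong[of "u k" "\<lambda>\<beta>. u k 0 * monomial_eval \<beta> (x k)"] u[OF that]
      homogenised_monomials[OF deg] by metis
  have prod: "y (\<beta> + \<gamma>) = (\<Sum>k\<in>K. u k \<beta> * u k \<gamma>)" if "\<beta> \<in> ?I" "\<gamma> \<in> ?I" for \<beta> \<gamma>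
  proof -
    have "y (\<beta> + \<gamma>) = (\<Sum>k\<in>?I. u k \<beta> * u k \<gamma>)"
      using v that gram by simp
    also have "\<dots> = (\<Sum>k\<in>K. u k \<beta> * u k \<gamma>)"
      using at_infinity[OF _ that(1)] finite_mindices[of 1]
      by (intro sum.mono_neutral_right) (auto simp: K_def)
    finally show ?thesis .
  qed
  show ?thesis
  proof (intro exI conjI ballI)
    show "0 < (u k 0)\<^sup>2" if "k \<in> K" for k
      using that by (simp add: K_def)
    then show "0 \<le> rpoly_eval q (x k)" if "k \<in> K" for k
      using that hom[OF that] nonneg[of k] by (auto simp: K_def zero_le_mult_iff)
    show "y \<alpha> = (\<Sum>k\<in>K. (u k 0)\<^sup>2 * monomial_eval \<alpha> (x k))"
      if \<alpha>: "\<alpha> \<in> mindices 2" for \<alpha>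
    proof -
      obtain \<beta> \<gamma> where "\<beta> \<in> ?I" "\<gamma> \<in> ?I" "\<alpha> = \<beta> + \<gamma>"
        using mindices_2_split[OF \<alpha>] by blast
      then show ?thesis
        unfolding \<open>\<alpha> = \<beta> + \<gamma>\<close> prod[OF \<open>\<beta> \<in> ?I\<close> \<open>\<gamma> \<in> ?I\<close>]
        by (intro sum.cong refl)
           (simp add: u[OF _ \<open>\<beta> \<in> ?I\<close>] u[OF _ \<open>\<gamma> \<in> ?I\<close>] monomial_eval_plus power2_eq_square)
    qed
    show "riesz 2 y q = (\<Sum>k\<in>K. (u k 0)\<^sup>2 * rpoly_eval q (x k))"
      using sum_homogenised_eq_riesz[of y u K q] prod hom by simp
  qed (rule finite)
qed

theorem theorem4p7:
  fixes q :: "'n::finite rpoly" and y :: "'n mindex \<Rightarrow> real"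
  assumes "total_degree q = 2"
    and "compact (nonneg_set q)" and "nonneg_set q \<noteq> {}"
  shows "((\<exists>\<mu>. representing_measure 2 y \<mu> \<and> measure_support \<mu> \<subseteq> zero_set q) \<longleftrightarrow>
          psd_on (mindices 1) (moment_matrix y) \<and> riesz 2 y q = 0) \<and>
         ((\<exists>\<mu>. representing_measure 2 y \<mu> \<and> measure_support \<mu> \<subseteq> nonneg_set q) \<longleftrightarrow>
          psd_on (mindices 1) (moment_matrix y) \<and> riesz 2 y q \<ge> 0)"
proof -
  have deg: "total_degree q \<le> 2"
    using assms(1) by simp
  have bdd: "bounded (nonneg_set q)"
    using assms(2) by (rule compact_imp_bounded)
  show ?thesis
  proof (intro conjI iffI)
    assume "\<exists>\<mu>. representing_measure 2 y \<mu> \<and> measure_support \<mu> \<subseteq> zero_set q"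
    then obtain \<mu> where \<mu>: "representing_measure 2 y \<mu>" "measure_support \<mu> \<subseteq> zero_set q"
      by blast
    then have "AE x in \<mu>. x \<in> zero_set q"
      by (intro AE_in_measure_support closed_zero_set) (auto simp: representing_measure_def)
    then have "AE x in \<mu>. rpoly_eval q x = 0"
      by (simp add: zero_set_def)
    then show "riesz 2 y q = 0"
      by (simp add: riesz_eq_integral[OF \<mu>(1) deg] integral_eq_zero_AE)
    show "psd_on (mindices 1) (moment_matrix y)"
      using \<mu>(1) by (rule psd_on_moment_matrix)
  next
    assume "\<exists>\<mu>. representing_measure 2 y \<mu> \<and> measure_support \<mu> \<subseteq> nonneg_set q"
    then obtain \<mu> where \<mu>: "representing_measure 2 y \<mu>" "measure_support \<mu> \<subseteq> nonneg_set q"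
      by blast
    then have "AE x in \<mu>. x \<in> nonneg_set q"
      by (intro AE_in_measure_support closed_nonneg_set) (auto simp: representing_measure_def)
    then have "AE x in \<mu>. 0 \<le> rpoly_eval q x"
      by (simp add: nonneg_set_def)
    then show "0 \<le> riesz 2 y q"
      by (simp add: riesz_eq_integral[OF \<mu>(1) deg] integral_nonneg_AE)
    show "psd_on (mindices 1) (moment_matrix y)"
      using \<mu>(1) by (rule psd_on_moment_matrix)
  next
    assume y: "psd_on (mindices 1) (moment_matrix y) \<and> riesz 2 y q = 0"
    then have "psd_on (mindices 1) (moment_matrix y)" "0 \<le> riesz 2 y q"
      by simp_all
    from psd_moment_atoms[OF deg bdd assms(3) this]
    obtain K :: "'n mindex set" and w x where K: "finite K" "\<forall>k\<in>K. 0 < w k"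
      "\<forall>k\<in>K. 0 \<le> rpoly_eval q (x k)"
      "\<forall>\<alpha>\<in>mindices 2. y \<alpha> = (\<Sum>k\<in>K. w k * monomial_eval \<alpha> (x k))"
      "riesz 2 y q = (\<Sum>k\<in>K. w k * rpoly_eval q (x k))"
      by (elim exE conjE)
    have "(\<Sum>k\<in>K. w k * rpoly_eval q (x k)) = 0"
      using y K(5) by simp
    then have "\<forall>k\<in>K. w k * rpoly_eval q (x k) = 0"
      using K(1-3) by (subst (asm) sum_nonneg_eq_0_iff) (auto simp: less_imp_le)
    then have "x k \<in> zero_set q" if "k \<in> K" for k
      using K(2) that by (force simp: zero_set_def)
    then show "\<exists>\<mu>. representing_measure 2 y \<mu> \<and> measure_support \<mu> \<subseteq> zero_set q"
      using K(1,2,4)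
      by (intro atomic_representing_measure[of K w 2 y x] closed_zero_set) (auto simp: less_imp_le)
  next
    assume "psd_on (mindices 1) (moment_matrix y) \<and> 0 \<le> riesz 2 y q"
    then have "psd_on (mindices 1) (moment_matrix y)" "0 \<le> riesz 2 y q"
      by simp_all
    from psd_moment_atoms[OF deg bdd assms(3) this]
    obtain K :: "'n mindex set" and w x where K: "finite K" "\<forall>k\<in>K. 0 < w k"
      "\<forall>k\<in>K. 0 \<le> rpoly_eval q (x k)"
      "\<forall>\<alpha>\<in>mindices 2. y \<alpha> = (\<Sum>k\<in>K. w k * monomial_eval \<alpha> (x k))"
      "riesz 2 y q = (\<Sum>k\<in>K. w k * rpoly_eval q (x k))"
      by (elim exE conjE)
    show "\<exists>\<mu>. representing_measure 2 y \<mu> \<and> measure_support \<mu> \<subseteq> nonneg_set q"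
      using K(1-4)
      by (intro atomic_representing_measure[of K w 2 y x] closed_nonneg_set)
         (auto simp: less_imp_le nonneg_set_def)
  qed
qed

end
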